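(* Let $A\in\mathcal{M}_n$ be positive definite. Then for every $Y\in\mathcal{M}_n$, $$\mathfrak{R}\left(YA^{-1}Y\right)\le(\mathfrak{R}Y)\,A^{-1}\,(\mathfrak{R}Y).$$
   Context: $\mathcal{M}_n$ is the algebra of $n\times n$ complex matrices, $\mathfrak{R}Y=\frac{Y+Y^*}{2}$ is the real part of $Y\in\mathcal{M}_n$, and for Hermitian $X,Z$, $X\le Z$ means that $Z-X$ is positive semidefinite. *)

theory Defs
  imports "HOL-Analysis.Analysis"
begin

definition adjoint_mat :: "complex ^ 'n ^ 'm \<Rightarrow> complex ^ 'm ^ 'n" where
  "adjoint_mat A = (\<chi> i j. cnj (A $ j $ i))"

definition hermitian_mat :: "complex ^ 'n ^ 'n \<Rightarrow> bool" where
  "hermitian_mat A \<longleftrightarrow> adjoint_mat A = A"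

(* The library inner product on complex ^ 'n is real-valued; this is the
   sesquilinear one, conjugate-linear in the first argument. *)
definition cinner_vec :: "complex ^ 'n \<Rightarrow> complex ^ 'n \<Rightarrow> complex" where
  "cinner_vec x y = (\<Sum>i\<in>UNIV. cnj (x $ i) * y $ i)"

(* For Hermitian A the value of the quadratic form is real, so taking Re
   only coerces it from complex to real. *)
definition psd_mat :: "complex ^ 'n ^ 'n \<Rightarrow> bool" where
  "psd_mat A \<longleftrightarrow> hermitian_mat A \<and> (\<forall>x. 0 \<le> Re (cinner_vec x (A *v x)))"

definition pd_mat :: "complex ^ 'n ^ 'n \<Rightarrow> bool" where
  "pd_mat A \<longleftrightarrow> hermitian_mat A \<and> (\<forall>x. x \<noteq> 0 \<longrightarrow> 0 < Re (cinner_vec x (A *v x)))"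

definition loewner_le :: "complex ^ 'n ^ 'n \<Rightarrow> complex ^ 'n ^ 'n \<Rightarrow> bool"
    (infix "\<le>\<^sub>L" 50) where
  "X \<le>\<^sub>L Z \<longleftrightarrow> hermitian_mat X \<and> hermitian_mat Z \<and> psd_mat (Z - X)"

definition real_part_mat :: "complex ^ 'n ^ 'n \<Rightarrow> complex ^ 'n ^ 'n" where
  "real_part_mat Y = (1 / 2) *\<^sub>R (Y + adjoint_mat Y)"

end

(* Write Y = H + S with H Hermitian and S skew-Hermitian, and B = A^-1. The mixed terms of Y B Y
   are skew-Hermitian in total, so the real part of Y B Y is H B H + S B S, and
   the difference to H B H is - S B S = S^* B S, which is positive semidefinite. *)
theory Submission
  imports Defs
begin

lemma adjoint_mat_add: "adjoint_mat (A + B) = adjoint_mat A + adjoint_mat B"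
  by (simp add: adjoint_mat_def vec_eq_iff)

lemma adjoint_mat_scaleR: "adjoint_mat (r *\<^sub>R A) = r *\<^sub>R adjoint_mat A"
  by (simp add: adjoint_mat_def vec_eq_iff)

lemma adjoint_mat_diff: "adjoint_mat (A - B) = adjoint_mat A - adjoint_mat B"
  by (simp add: adjoint_mat_def vec_eq_iff)

lemma adjoint_mat_adjoint_mat [simp]: "adjoint_mat (adjoint_mat A) = A"
  by (simp add: adjoint_mat_def vec_eq_iff)

lemma adjoint_mat_mult: "adjoint_mat (A ** B) = adjoint_mat B ** adjoint_mat A"
  by (simp add: adjoint_mat_def matrix_matrix_mult_def vec_eq_iff mult.commute)

lemma adjoint_mat_mat_1: "adjoint_mat (mat 1) = mat 1"
  by (simp add: adjoint_mat_def mat_def vec_eq_iff)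

lemma matrix_add_rdistrib: "(A + B) ** C = A ** C + B ** C"
  by (simp add: matrix_matrix_mult_def vec_eq_iff sum.distrib distrib_right)

lemma matrix_diff_ldistrib: "A ** (B - C) = A ** B - A ** (C :: 'a::ring_1 ^ 'k ^ 'm)"
  by (simp add: matrix_matrix_mult_def vec_eq_iff sum_subtractf right_diff_distrib)

lemma matrix_diff_rdistrib: "(A - B) ** C = A ** C - B ** (C :: 'a::ring_1 ^ 'k ^ 'm)"
  by (simp add: matrix_matrix_mult_def vec_eq_iff sum_subtractf left_diff_distrib)

lemma matrix_inv_invertible:
  assumes "invertible A"
  shows "A ** matrix_inv A = mat 1" "matrix_inv A ** A = mat 1"
  \<comment> \<open>\<open>matrix_inv\<close> is a Hilbert choice of a two-sided inverse;
    invertibility supplies the existence that the choice requires.\<close>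
  using someI_ex[OF assms[unfolded invertible_def]] by (simp_all add: matrix_inv_def)

lemma cinner_vec_adjoint: "cinner_vec (A *v x) y = cinner_vec x (adjoint_mat A *v y)"
proof -
  have "cinner_vec (A *v x) y = (\<Sum>i\<in>UNIV. \<Sum>j\<in>UNIV. cnj (A $ i $ j) * cnj (x $ j) * y $ i)"
    by (simp add: cinner_vec_def matrix_vector_mult_def sum_distrib_right)
  also have "\<dots> = (\<Sum>j\<in>UNIV. \<Sum>i\<in>UNIV. cnj (A $ i $ j) * cnj (x $ j) * y $ i)"
    by (rule sum.swap)
  also have "\<dots> = cinner_vec x (adjoint_mat A *v y)"
    by (simp add: cinner_vec_def matrix_vector_mult_def adjoint_mat_def sum_distrib_left mult_ac)
  finally show ?thesis .
qed

text \<open>A kernel vector makes the quadratic form vanish, so positive definiteness forces it to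
  be 0; for a square matrix a trivial kernel suffices.\<close>

lemma pd_mat_invertible:
  assumes "pd_mat A"
  shows "invertible A"
proof -
  have "x = 0" if "A *v x = 0" for x
    using assms that by (force simp: pd_mat_def cinner_vec_def)
  then show ?thesis
    by (simp add: invertible_left_inverse matrix_left_invertible_ker)
qed

text \<open>Taking adjoints in A B = 1 shows that the adjoint of B is a left inverse of A, and a
  left inverse agrees with the right inverse B.\<close>

lemma hermitian_mat_matrix_inv:
  assumes "hermitian_mat A" "invertible A"
  shows "hermitian_mat (matrix_inv A)"
proof -
  let ?B = "matrix_inv A"
  have AB: "A ** ?B = mat 1" and BA: "?B ** A = mat 1"
    using assms(2) by (simp_all add: matrix_inv_invertible)
  have "adjoint_mat ?B ** A = mat 1"
    using arg_cong[OF AB, of adjoint_mat] assms(1)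
    by (simp add: adjoint_mat_mult adjoint_mat_mat_1 hermitian_mat_def)
  then have "adjoint_mat ?B ** A ** ?B = ?B"
    by simp
  then show ?thesis
    by (simp add: hermitian_mat_def matrix_mul_assoc[symmetric] AB)
qed

text \<open>The substitution x = A v turns the form of the inverse at x into the form of A at v,
  because A is self-adjoint.\<close>

lemma psd_mat_matrix_inv:
  assumes "pd_mat A"
  shows "psd_mat (matrix_inv A)"
proof -
  have inv: "invertible A" and herm: "hermitian_mat A"
    using assms pd_mat_invertible by (auto simp: pd_mat_def)
  have "0 \<le> Re (cinner_vec x (matrix_inv A *v x))" for x
  proof -
    define v where "v = matrix_inv A *v x"
    have x: "x = A *v v"
      using inv by (simp add: v_def matrix_vector_mul_assoc matrix_inv_invertible)
    have "cinner_vec x (matrix_inv A *v x) = cinner_vec v (A *v v)"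
      using herm by (metis cinner_vec_adjoint hermitian_mat_def v_def x)
    moreover have "0 \<le> Re (cinner_vec v (A *v v))"
      \<comment> \<open>\<open>pd_mat\<close> speaks only of nonzero vectors; at v = 0 the form is
        0.\<close>
      using assms by (cases "v = 0") (auto simp: pd_mat_def cinner_vec_def less_imp_le)
    ultimately show ?thesis by simp
  qed
  then show ?thesis
    using hermitian_mat_matrix_inv[OF herm inv] by (simp add: psd_mat_def)
qed

text \<open>The form of the product at x is the form of B at S x.\<close>

lemma psd_mat_congruence:
  assumes "psd_mat B"
  shows "psd_mat (adjoint_mat S ** B ** S)"
proof -
  have "cinner_vec x ((adjoint_mat S ** B ** S) *v x) = cinner_vec (S *v x) (B *v (S *v x))" for x
    by (simp add: cinner_vec_adjoint matrix_vector_mul_assoc matrix_mul_assoc)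
  then show ?thesis
    using assms by (simp add: psd_mat_def hermitian_mat_def adjoint_mat_mult matrix_mul_assoc)
qed

lemma hermitian_mat_real_part_mat: "hermitian_mat (real_part_mat Y)"
  by (simp add: hermitian_mat_def real_part_mat_def adjoint_mat_scaleR adjoint_mat_add add.commute)

text \<open>\<open>S Y\<close> is the skew-Hermitian part of Y. The identity exhibits the gap
  between the two sides of the inequality as a congruence of B, from which positivity can be read
  off.\<close>

lemma real_part_mat_sandwich:
  assumes "hermitian_mat B"
  defines "S \<equiv> \<lambda>Y. (1 / 2) *\<^sub>R (Y - adjoint_mat Y)"
  shows "real_part_mat Y ** B ** real_part_mat Y - real_part_mat (Y ** B ** Y)
    = adjoint_mat (S Y) ** B ** S Y"
proof -
  \<comment> \<open>The adjoint reverses the factors, but the product is a palindrome and B is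
    Hermitian, so only Y changes.\<close>
  have adj: "adjoint_mat (Y ** B ** Y) = adjoint_mat Y ** B ** adjoint_mat Y"
    using assms(1) by (simp add: adjoint_mat_mult hermitian_mat_def matrix_mul_assoc)
  show ?thesis
    \<comment> \<open>With Y' the adjoint of Y, both sides expand to (Y B Y' + Y' B Y - Y B Y - Y' B
      Y') / 4. Once the products are multiplied out, the identity is linear in these four and is
      checked entrywise on real and imaginary parts.\<close>
    unfolding S_def real_part_mat_def adj
    by (simp add: adjoint_mat_scaleR adjoint_mat_diff matrix_scalar_ac
        scalar_matrix_assoc[symmetric] matrix_add_ldistrib matrix_add_rdistrib
        matrix_diff_ldistrib matrix_diff_rdistrib)
      (simp add: vec_eq_iff complex_eq_iff field_simps)
qed

theorem theorem2p5:
  fixes A Y :: "complex ^ 'n ^ 'n"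
  assumes "pd_mat A"
  shows "real_part_mat (Y ** matrix_inv A ** Y)
           \<le>\<^sub>L real_part_mat Y ** matrix_inv A ** real_part_mat Y"
proof -
  have B: "psd_mat (matrix_inv A)" and herm: "hermitian_mat (matrix_inv A)"
    using psd_mat_matrix_inv[OF assms] by (auto simp: psd_mat_def)
  have "hermitian_mat (real_part_mat Y ** matrix_inv A ** real_part_mat Y)"
    using herm hermitian_mat_real_part_mat[of Y]
    by (simp add: hermitian_mat_def adjoint_mat_mult matrix_mul_assoc)
  then show ?thesis
    \<comment> \<open>The congruence is applied with the skew-Hermitian part of Y, as the sandwich
      identity dictates.\<close>
    using psd_mat_congruence[OF B]
    by (simp add: loewner_le_def hermitian_mat_real_part_mat real_part_mat_sandwich[OF herm])
qed

end
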